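(* Let $G=(V,E)$ be a simple undirected graph with $V=\{1,\dots,n\}$ and $m$ edges, and let $A_G\in\mathbb{C}^{n\times n\times n\times n}$ be defined as below. Then \[ \|A_G\|_{\sigma,\mathbb{C}}=\max_{0\ne x,y,u,v\in\mathbb{C}^n}\frac{|\langle A_G,x\otimes y\otimes u\otimes v\rangle|}{\|x\|\|y\|\|u\|\|v\|}=\max_{0\ne y\in\mathbb{R}^n_+}\frac{\langle A_G,y\otimes y\otimes y\otimes y\rangle}{\|y\|^4}, \] and \[ \frac{\kappa(G)-1}{\kappa(G)}=\|A_G\|_{\sigma,\mathbb{C}}=\|A_G\|_{\sigma,\mathbb{R}}, \] where $\kappa(G)$ is the clique number of $G$ (size of a largest clique).
   Context: For $1\le s<t\le n$, $A_{st}=(a^{(s,t)}_{ijkl})\in\mathbb{C}^{n\times n\times n\times n}$ has $a^{(s,t)}_{ijkl}=1/2$ when $(i,j,k,l)\in\{(s,t,s,t),(t,s,t,s),(s,t,t,s),(t,s,s,t)\}$ and $0$ otherwise; $A_G=\sum_{\{s,t\}\in E}A_{st}$ (each edge counted once). $\langle A,B\rangle=\sum a_{ijkl}\overline{b_{ijkl}}$, $\|\cdot\|$ Euclidean norm, $\mathbb{R}^n_+$ the nonnegative orthant. For $\mathbb{F}\in\{\mathbb{R},\mathbb{C}\}$, $\|A\|_{\sigma,\mathbb{F}}=\sup\{|\langle A,x\otimes y\otimes u\otimes v\rangle|/(\|x\|\|y\|\|u\|\|v\|):0\ne x,y,u,v\in\mathbb{F}^n\}$. *)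

theory Defs
  imports "HOL-Analysis.Analysis" "HOL-Library.Ramsey"
begin

text \<open>
  The vertex set \<open>{1,\<dots>,n}\<close> is the universe of a finite, linearly ordered type \<open>'n\<close>, so that
  \<open>n = CARD('n) \<ge> 1\<close> and \<open>\<complex>\<^sup>n\<close> is \<open>complex ^ 'n\<close> with its Euclidean norm.  A graph is
  given by its set of edges, which are two-element sets of vertices.
\<close>

type_synonym 'n tensor4 = "complex ^ 'n ^ 'n ^ 'n ^ 'n"

definition tensor_inner :: "'n::finite tensor4 \<Rightarrow> 'n tensor4 \<Rightarrow> complex" where
  "tensor_inner A B = (\<Sum>i\<in>UNIV. \<Sum>j\<in>UNIV. \<Sum>k\<in>UNIV. \<Sum>l\<in>UNIV. A$i$j$k$l * cnj (B$i$j$k$l))"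

definition tensor_product ::
    "complex ^ 'n \<Rightarrow> complex ^ 'n \<Rightarrow> complex ^ 'n \<Rightarrow> complex ^ 'n \<Rightarrow> 'n::finite tensor4" where
  "tensor_product x y u v = (\<chi> i j k l. x$i * y$j * u$k * v$l)"

definition edge_tensor :: "'n \<Rightarrow> 'n \<Rightarrow> 'n::finite tensor4" where
  "edge_tensor s t = (\<chi> i j k l.
     if (i, j, k, l) \<in> {(s, t, s, t), (t, s, t, s), (s, t, t, s), (t, s, s, t)} then 1/2 else 0)"

definition graph_tensor :: "'n set set \<Rightarrow> 'n::{finite,linorder} tensor4" where
  "graph_tensor E = (\<Sum>(s, t)\<in>{(s, t). s < t \<and> {s, t} \<in> E}. edge_tensor s t)"

text \<open>
  The subsets \<open>\<real>\<^sup>n\<close>, \<open>\<real>\<^sup>n\<^sub>+\<close> and \<open>\<complex>\<^sup>n\<close> of \<open>\<complex>\<^sup>n\<close> are \<open>vectors_over \<real>\<close>,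
  \<open>vectors_over nonneg_Reals\<close> and \<open>vectors_over UNIV\<close>.
\<close>

definition vectors_over :: "complex set \<Rightarrow> (complex ^ 'n::finite) set" where
  "vectors_over F = {x. \<forall>i. x$i \<in> F}"

definition spectral_norm :: "complex set \<Rightarrow> 'n::finite tensor4 \<Rightarrow> real" where
  "spectral_norm F A =
     Sup {cmod (tensor_inner A (tensor_product x y u v)) / (norm x * norm y * norm u * norm v) |
          x y u v. x \<in> vectors_over F - {0} \<and> y \<in> vectors_over F - {0} \<and>
                   u \<in> vectors_over F - {0} \<and> v \<in> vectors_over F - {0}}"

definition is_maximum :: "real set \<Rightarrow> real \<Rightarrow> bool" where
  "is_maximum S M \<longleftrightarrow> M \<in> S \<and> (\<forall>r\<in>S. r \<le> M)"

definition clique_number :: "'n::finite set set \<Rightarrow> nat" where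
  "clique_number E = Max (card ` {W. clique W E})"

text \<open>
  On real vectors the form of a graph tensor is real-valued, so that taking its real part
  loses nothing.
\<close>

lemma tensor_inner_graph_tensor_Reals:
  fixes E :: "'n::{finite,linorder} set set"
  assumes "y \<in> vectors_over \<real>"
  shows "tensor_inner (graph_tensor E) (tensor_product y y y y) \<in> \<real>"
proof -
  have y: "y$i \<in> \<real>" for i
    using assms by (simp add: vectors_over_def)
  have A: "graph_tensor E $ i $ j $ k $ l \<in> \<real>" for i j k l
    unfolding graph_tensor_def sum_component
    by (intro sum_in_Reals) (auto simp: edge_tensor_def)
  show ?thesis
    unfolding tensor_inner_def tensor_product_def
    by (intro sum_in_Reals Reals_mult A) (use y in \<open>simp add: Reals_cnj_iff\<close>)
qed

end

theory Submission
  imports Defs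
begin

text \<open>
  By the triangle inequality it suffices to bound the form on nonnegative vectors.  For fixed
  \<open>x, y\<close> it is a symmetric bilinear form in \<open>u, v\<close> with nonnegative coefficients, and its diagonal
  \<open>u = v\<close> is in turn such a form in \<open>x, y\<close>; such forms are bounded by their quadratic forms
  on nonnegative vectors.  This reduces to \<open>x = y\<close> and \<open>u = v\<close>, where the value is
  the Motzkin--Straus quadratic form of the graph at \<open>p\<^sub>i = x\<^sub>i u\<^sub>i\<close>, and \<open>\<Sum>p\<^sub>i \<le> \<parallel>x\<parallel> \<parallel>u\<parallel>\<close>.
\<close>

section \<open>Adjacency matrix and bilinear forms\<close>

text \<open>The conjunct \<open>s \<noteq> t\<close> keeps the diagonal zero even if a singleton
  lies in \<open>E\<close>, in agreement with the strict order in
  \<open>graph_tensor\<close>.\<close>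

definition adj :: "'n set set \<Rightarrow> 'n \<Rightarrow> 'n \<Rightarrow> real" where
  "adj E s t = of_bool (s \<noteq> t \<and> {s, t} \<in> E)"

lemma adj_commute: "adj E s t = adj E t s"
  by (auto simp: adj_def insert_commute)

lemma adj_nonneg: "0 \<le> adj E s t"
  by (simp add: adj_def)

lemma adj_le: "adj E s t \<le> of_bool (s \<noteq> t)"
  by (simp add: adj_def)

definition bilinear_sum :: "('n::finite \<Rightarrow> 'n \<Rightarrow> real) \<Rightarrow> ('n \<Rightarrow> real) \<Rightarrow> ('n \<Rightarrow> real) \<Rightarrow> real" where
  "bilinear_sum M u v = (\<Sum>s\<in>UNIV. \<Sum>t\<in>UNIV. M s t * u s * v t)"

lemma bilinear_sum_commute:
  assumes "\<And>s t. M s t = M t s"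
  shows "bilinear_sum M u v = bilinear_sum M v u"
  unfolding bilinear_sum_def
  by (subst sum.swap, intro sum.cong refl, subst assms, simp add: mult_ac)

lemma bilinear_sum_add_left: "bilinear_sum M (\<lambda>i. u i + w i) v = bilinear_sum M u v + bilinear_sum M w v"
  by (simp add: bilinear_sum_def algebra_simps sum.distrib)

lemma bilinear_sum_add_right: "bilinear_sum M u (\<lambda>i. v i + w i) = bilinear_sum M u v + bilinear_sum M u w"
  by (simp add: bilinear_sum_def algebra_simps sum.distrib)

lemma bilinear_sum_diff_left: "bilinear_sum M (\<lambda>i. u i - w i) v = bilinear_sum M u v - bilinear_sum M w v"
  by (simp add: bilinear_sum_def algebra_simps sum_subtractf)

lemma bilinear_sum_diff_right: "bilinear_sum M u (\<lambda>i. v i - w i) = bilinear_sum M u v - bilinear_sum M u w"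
  by (simp add: bilinear_sum_def algebra_simps sum_subtractf)

lemma bilinear_sum_scale_left: "bilinear_sum M (\<lambda>i. a * u i) v = a * bilinear_sum M u v"
  by (simp add: bilinear_sum_def sum_distrib_left mult_ac)

lemma bilinear_sum_scale_right: "bilinear_sum M u (\<lambda>i. a * v i) = a * bilinear_sum M u v"
  by (simp add: bilinear_sum_def sum_distrib_left mult_ac)

lemma bilinear_sum_indicator_left:
  "bilinear_sum M (\<lambda>i. of_bool (i = s)) v = (\<Sum>t\<in>UNIV. M s t * v t)"
proof -
  have "bilinear_sum M (\<lambda>i. of_bool (i = s)) v =
      (\<Sum>i\<in>UNIV. if i = s then \<Sum>t\<in>UNIV. M s t * v t else 0)"
    unfolding bilinear_sum_def by (intro sum.cong) auto
  then show ?thesis by simp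
qed

lemma bilinear_sum_indicator:
  "bilinear_sum M (\<lambda>i. of_bool (i = s)) (\<lambda>i. of_bool (i = t)) = M s t"
  by (simp add: bilinear_sum_indicator_left)

section \<open>Clique number and the Motzkin--Straus inequality\<close>

lemma clique_number_ge:
  assumes "clique W E"
  shows "card W \<le> clique_number E"
  unfolding clique_number_def using assms by (intro Max_ge) auto

lemma clique_number_attained:
  obtains W where "clique W E" "card W = clique_number E"
proof -
  have "clique_number E \<in> card ` {W. clique W E}"
    unfolding clique_number_def
    by (intro Max_in) (auto simp: clique_def intro: exI[of _ "{}"])
  then show ?thesis using that by auto
qed

text \<open>A single vertex is a clique. Hence \<open>1 / clique_number E\<close> is a genuine
  quotient and \<open>1 - 1 / clique_number E\<close> is nonnegative.\<close>

lemma clique_number_pos: "0 < clique_number E"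
  using clique_number_ge[of "{undefined}" E] by (simp add: clique_def)

text \<open>The right-hand side is the form of the complete graph, whose matrix (all ones minus the
  identity) dominates \<open>adj E\<close> entrywise.\<close>

lemma bilinear_sum_adj_le:
  fixes p :: "'n::finite \<Rightarrow> real"
  assumes "\<And>i. 0 \<le> p i"
  shows "bilinear_sum (adj E) p p \<le> (\<Sum>i\<in>UNIV. p i)\<^sup>2 - (\<Sum>i\<in>UNIV. (p i)\<^sup>2)"
proof -
  have "bilinear_sum (adj E) p p \<le> (\<Sum>s\<in>UNIV. \<Sum>t\<in>UNIV. of_bool (s \<noteq> t) * p s * p t)"
    unfolding bilinear_sum_def by (intro sum_mono mult_right_mono adj_le assms)
  also have "\<dots> = (\<Sum>s\<in>UNIV. \<Sum>t\<in>UNIV. p s * p t - (if t = s then (p s)\<^sup>2 else 0))"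
    by (intro sum.cong refl) (auto simp: power2_eq_square)
  also have "\<dots> = (\<Sum>i\<in>UNIV. p i)\<^sup>2 - (\<Sum>i\<in>UNIV. (p i)\<^sup>2)"
    by (simp add: sum_subtractf power2_eq_square sum_product)
  finally show ?thesis .
qed

text \<open>Shifting mass between two non-adjacent vertices changes the form linearly, so one of the
  two directions does not decrease it; this ends with a weight supported on a clique.\<close>
lemma motzkin_straus:
  fixes p :: "'n::finite \<Rightarrow> real"
  assumes "\<And>i. 0 \<le> p i"
  shows "bilinear_sum (adj E) p p \<le> (1 - 1 / clique_number E) * (\<Sum>i\<in>UNIV. p i)\<^sup>2"
  using assms
proof (induction "card {i. p i \<noteq> 0}" arbitrary: p rule: less_induct)
  case less
  let ?k = "real (clique_number E)"
  have k: "?k > 0" using clique_number_pos[of E] by simp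
  define W where "W = {i. p i \<noteq> 0}"
  show ?case
  proof (cases "clique W E")
    case True
    \<comment> \<open>Restricting to the support makes Cauchy--Schwarz produce the factor
      \<open>card W\<close>, which the clique number bounds.\<close>
    have "(\<Sum>i\<in>UNIV. p i) = (\<Sum>i\<in>W. p i)"
      by (rule sum.mono_neutral_right) (auto simp: W_def)
    moreover have "(\<Sum>i\<in>UNIV. (p i)\<^sup>2) = (\<Sum>i\<in>W. (p i)\<^sup>2)"
      by (rule sum.mono_neutral_right) (auto simp: W_def)
    ultimately have "(\<Sum>i\<in>UNIV. p i)\<^sup>2 \<le> (\<Sum>i\<in>UNIV. (p i)\<^sup>2) * card W"
      using sum_squared_le_sum_of_squares[of p W] by simp
    also have "\<dots> \<le> (\<Sum>i\<in>UNIV. (p i)\<^sup>2) * ?k"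
      using clique_number_ge[OF True] by (intro mult_left_mono sum_nonneg) auto
    finally have "(\<Sum>i\<in>UNIV. p i)\<^sup>2 / ?k \<le> (\<Sum>i\<in>UNIV. (p i)\<^sup>2)"
      using k by (simp add: divide_simps)
    moreover have "bilinear_sum (adj E) p p \<le> (\<Sum>i\<in>UNIV. p i)\<^sup>2 - (\<Sum>i\<in>UNIV. (p i)\<^sup>2)"
      by (rule bilinear_sum_adj_le) (rule less.prems)
    ultimately show ?thesis by (simp add: algebra_simps)
  next
    case False
    \<comment> \<open>Half the partial derivative of the form at \<open>p\<close>. It decides which
      of two non-adjacent vertices receives the mass.\<close>
    define g where "g i = (\<Sum>j\<in>UNIV. adj E i j * p j)" for i
    obtain s0 t0 where st0: "s0 \<in> W" "t0 \<in> W" "s0 \<noteq> t0" "{s0, t0} \<notin> E"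
      using False by (auto simp: clique_def)
    obtain s t where st: "s \<in> W" "t \<in> W" "s \<noteq> t" "{s, t} \<notin> E" "g t \<le> g s"
    proof (cases "g t0 \<le> g s0")
      case True
      then show ?thesis using that st0 by blast
    next
      case False
      then show ?thesis using that[of t0 s0] st0 by (auto simp: insert_commute)
    qed
    \<comment> \<open>The step length \<open>p t\<close> along \<open>h\<close> moves all the mass
      of \<open>t\<close> to \<open>s\<close>.\<close>
    define h where "h = (\<lambda>i. of_bool (i = s) - (of_bool (i = t) :: real))"
    define q where "q = (\<lambda>i. p i + p t * h i)"
    have q_nonneg: "0 \<le> q i" for i
      using less.prems st by (auto simp: q_def h_def)
    \<comment> \<open>Without an edge between \<open>s\<close> and \<open>t\<close> the quadratic
      term in \<open>h\<close> vanishes, leaving a change proportional to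
      \<open>g s - g t\<close>.\<close>
    have "adj E s s = 0" "adj E t t = 0" "adj E s t = 0" "adj E t s = 0"
      using st by (simp_all add: adj_def insert_commute)
    then have "bilinear_sum (adj E) h h = 0"
      by (simp add: h_def bilinear_sum_diff_left bilinear_sum_diff_right bilinear_sum_indicator)
    moreover have "bilinear_sum (adj E) h p = g s - g t"
      by (simp add: h_def bilinear_sum_diff_left bilinear_sum_indicator_left g_def)
    moreover have "bilinear_sum (adj E) p h = bilinear_sum (adj E) h p"
      by (rule bilinear_sum_commute) (rule adj_commute)
    ultimately have "bilinear_sum (adj E) q q = bilinear_sum (adj E) p p + 2 * p t * (g s - g t)"
      unfolding q_def bilinear_sum_add_left bilinear_sum_add_right
        bilinear_sum_scale_left bilinear_sum_scale_right by simp
    then have "bilinear_sum (adj E) p p \<le> bilinear_sum (adj E) q q"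
      using st(5) less.prems[of t] by simp
    \<comment> \<open>The vertex \<open>s\<close> was in the support already and \<open>t\<close>
      leaves it, so the induction hypothesis applies to \<open>q\<close>.\<close>
    also have "{i. q i \<noteq> 0} \<subset> W"
      using st less.prems[of t] by (auto simp: q_def h_def W_def)
    then have "card {i. q i \<noteq> 0} < card {i. p i \<noteq> 0}"
      unfolding W_def by (rule psubset_card_mono[rotated]) simp
    then have "bilinear_sum (adj E) q q \<le> (1 - 1 / ?k) * (\<Sum>i\<in>UNIV. q i)\<^sup>2"
      using less.hyps q_nonneg by blast
    also have "(\<Sum>i\<in>UNIV. q i) = (\<Sum>i\<in>UNIV. p i)"
      by (simp add: q_def h_def sum.distrib sum_subtractf flip: sum_distrib_left)
    finally show ?thesis .
  qed
qed

section \<open>From quadratic to bilinear bounds\<close>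

text \<open>By polarization, since the form at \<open>u - v\<close> is at least minus the form at \<open>\<bar>u - v\<bar>\<close>.\<close>
lemma bilinear_sum_le_of_quadratic:
  fixes M :: "'n::finite \<Rightarrow> 'n \<Rightarrow> real"
  assumes sym: "\<And>s t. M s t = M t s" and nonneg: "\<And>s t. 0 \<le> M s t"
    and quad: "\<And>w. (\<And>i. 0 \<le> w i) \<Longrightarrow> bilinear_sum M w w \<le> c * (L2_set w UNIV)\<^sup>2"
    and u: "\<And>i. 0 \<le> u i" and v: "\<And>i. 0 \<le> v i"
  shows "bilinear_sum M u v \<le> c * L2_set u UNIV * L2_set v UNIV"
proof -
  have L2: "(L2_set w UNIV)\<^sup>2 = (\<Sum>i\<in>UNIV. (w i)\<^sup>2)" for w :: "'n \<Rightarrow> real"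
    by (simp add: L2_set_def sum_nonneg)
  \<comment> \<open>The additive version of the bound; the product version follows from it by
    rescaling.\<close>
  have half: "2 * bilinear_sum M u v \<le> c * ((L2_set u UNIV)\<^sup>2 + (L2_set v UNIV)\<^sup>2)"
    if u: "\<And>i. 0 \<le> u i" and v: "\<And>i. 0 \<le> v i" for u v
  proof -
    have "bilinear_sum M (\<lambda>i. u i + v i) (\<lambda>i. u i + v i) \<le> c * (\<Sum>i\<in>UNIV. (u i + v i)\<^sup>2)"
      using quad[of "\<lambda>i. u i + v i"] u v by (simp add: L2)
    moreover have "- bilinear_sum M (\<lambda>i. u i - v i) (\<lambda>i. u i - v i)
        \<le> bilinear_sum M (\<lambda>i. \<bar>u i - v i\<bar>) (\<lambda>i. \<bar>u i - v i\<bar>)"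
      unfolding bilinear_sum_def sum_negf[symmetric]
    proof (intro sum_mono)
      fix s t
      have "M s t * - ((u s - v s) * (u t - v t)) \<le> M s t * \<bar>(u s - v s) * (u t - v t)\<bar>"
        by (intro mult_left_mono nonneg) simp
      then show "- (M s t * (u s - v s) * (u t - v t)) \<le> M s t * \<bar>u s - v s\<bar> * \<bar>u t - v t\<bar>"
        by (simp add: abs_mult mult.assoc)
    qed
    moreover have "bilinear_sum M (\<lambda>i. \<bar>u i - v i\<bar>) (\<lambda>i. \<bar>u i - v i\<bar>) \<le> c * (\<Sum>i\<in>UNIV. (u i - v i)\<^sup>2)"
      using quad[of "\<lambda>i. \<bar>u i - v i\<bar>"] by (simp add: L2)
    moreover have "bilinear_sum M v u = bilinear_sum M u v"
      by (rule bilinear_sum_commute) (rule sym)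
    ultimately have "4 * bilinear_sum M u v
        \<le> c * (\<Sum>i\<in>UNIV. (u i + v i)\<^sup>2) + c * (\<Sum>i\<in>UNIV. (u i - v i)\<^sup>2)"
      by (simp add: bilinear_sum_add_left bilinear_sum_add_right
          bilinear_sum_diff_left bilinear_sum_diff_right)
    also have "\<dots> = c * (\<Sum>i\<in>UNIV. (u i + v i)\<^sup>2 + (u i - v i)\<^sup>2)"
      by (simp add: sum.distrib distrib_left)
    also have "(\<Sum>i\<in>UNIV. (u i + v i)\<^sup>2 + (u i - v i)\<^sup>2) = 2 * ((L2_set u UNIV)\<^sup>2 + (L2_set v UNIV)\<^sup>2)"
      unfolding L2 sum.distrib[symmetric] sum_distrib_left
      by (intro sum.cong refl) (simp add: power2_eq_square algebra_simps)
    finally show ?thesis by (simp add: algebra_simps)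
  qed
  define a b where "a = L2_set u UNIV" and "b = L2_set v UNIV"
  have ab: "0 \<le> a" "0 \<le> b" by (simp_all add: a_def b_def)
  show ?thesis
  proof (cases "a * b = 0")
    case True
    then have "(\<forall>i. u i = 0) \<or> (\<forall>i. v i = 0)"
      by (simp add: a_def b_def L2_set_eq_0_iff)
    then have "bilinear_sum M u v = 0" by (auto simp: bilinear_sum_def)
    with True show ?thesis by (auto simp: a_def b_def)
  next
    case False
    then have pos: "0 < a * b" using ab by simp
    \<comment> \<open>With these factors both vectors have norm \<open>a * b\<close>, so the mean of
      the squared norms equals the product of the norms.\<close>
    have "2 * bilinear_sum M (\<lambda>i. b * u i) (\<lambda>i. a * v i)
        \<le> c * ((L2_set (\<lambda>i. b * u i) UNIV)\<^sup>2 + (L2_set (\<lambda>i. a * v i) UNIV)\<^sup>2)"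
      using ab u v by (intro half) auto
    also have "\<dots> = 2 * ((a * b) * (c * a * b))"
      using ab by (simp flip: L2_set_right_distrib add: a_def[symmetric] b_def[symmetric]
          power2_eq_square algebra_simps)
    finally have "(a * b) * bilinear_sum M u v \<le> (a * b) * (c * a * b)"
      by (simp add: bilinear_sum_scale_left bilinear_sum_scale_right mult_ac)
    then show ?thesis using pos unfolding a_def b_def by (rule mult_left_le_imp_le)
  qed
qed

section \<open>The quartic form of the graph on nonnegative vectors\<close>

text \<open>The form of the graph tensor at real vectors, summed over ordered pairs: each
  orientation of an edge carries two of its four entries 1/2.\<close>

definition graph_form ::
    "'n::finite set set \<Rightarrow> ('n \<Rightarrow> real) \<Rightarrow> ('n \<Rightarrow> real) \<Rightarrow> ('n \<Rightarrow> real) \<Rightarrow> ('n \<Rightarrow> real) \<Rightarrow> real" where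
  "graph_form E x y u v =
     (\<Sum>s\<in>UNIV. \<Sum>t\<in>UNIV. adj E s t * (x s * y t * u s * v t + x s * y t * u t * v s) / 2)"

text \<open>Exchanging \<open>s\<close> and \<open>t\<close> in the second summand moves the
  asymmetry from \<open>u\<close>, \<open>v\<close> to \<open>x\<close>, \<open>y\<close>. The
  resulting matrix is symmetric, as \<open>bilinear_sum_le_of_quadratic\<close> demands.\<close>

lemma graph_form_eq_bilinear_sum:
  "graph_form E x y u v = bilinear_sum (\<lambda>s t. adj E s t * (x s * y t + y s * x t) / 2) u v"
proof -
  have "(\<Sum>s\<in>UNIV. \<Sum>t\<in>UNIV. adj E s t * (x s * y t * u t * v s) / 2)
      = (\<Sum>s\<in>UNIV. \<Sum>t\<in>UNIV. adj E s t * (y s * x t * u s * v t) / 2)"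
    by (subst sum.swap, intro sum.cong refl, subst adj_commute, simp add: mult_ac)
  then show ?thesis
    by (simp add: graph_form_def bilinear_sum_def sum.distrib add_divide_distrib algebra_simps)
qed

lemma graph_form_le:
  fixes x y u v :: "'n::finite \<Rightarrow> real"
  assumes x: "\<And>i. 0 \<le> x i" and y: "\<And>i. 0 \<le> y i" and u: "\<And>i. 0 \<le> u i" and v: "\<And>i. 0 \<le> v i"
  shows "graph_form E x y u v \<le> (1 - 1 / clique_number E) *
    (L2_set x UNIV * L2_set y UNIV * L2_set u UNIV * L2_set v UNIV)"
proof -
  let ?c = "1 - 1 / real (clique_number E)"
  have c: "0 \<le> ?c" using clique_number_pos[of E] by simp
  \<comment> \<open>The case of two coinciding pairs: Motzkin--Straus with weights
    \<open>w i * z i\<close>, then Cauchy--Schwarz for their sum.\<close>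
  have two: "bilinear_sum (\<lambda>s t. adj E s t * w s * w t) z z
      \<le> ?c * (L2_set w UNIV)\<^sup>2 * (L2_set z UNIV)\<^sup>2"
    if w: "\<And>i. 0 \<le> w i" and z: "\<And>i. 0 \<le> z i" for w z :: "'n \<Rightarrow> real"
  proof -
    have "bilinear_sum (\<lambda>s t. adj E s t * w s * w t) z z
        = bilinear_sum (adj E) (\<lambda>i. w i * z i) (\<lambda>i. w i * z i)"
      by (simp add: bilinear_sum_def mult_ac)
    also have "\<dots> \<le> ?c * (\<Sum>i\<in>UNIV. w i * z i)\<^sup>2"
      using w z by (intro motzkin_straus) simp
    also have "(\<Sum>i\<in>UNIV. w i * z i) \<le> L2_set w UNIV * L2_set z UNIV"
      using L2_set_mult_ineq[of w z UNIV] w z by simp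
    then have "?c * (\<Sum>i\<in>UNIV. w i * z i)\<^sup>2 \<le> ?c * (L2_set w UNIV * L2_set z UNIV)\<^sup>2"
      using w z c by (intro mult_left_mono power_mono sum_nonneg) auto
    finally show ?thesis by (simp add: power_mult_distrib mult.assoc)
  qed
  \<comment> \<open>First polarization, with \<open>w\<close> fixed and its squared norm absorbed
    into the constant.\<close>
  have three: "bilinear_sum (\<lambda>s t. adj E s t * w s * w t) x y
      \<le> ?c * (L2_set w UNIV)\<^sup>2 * L2_set x UNIV * L2_set y UNIV"
    if w: "\<And>i. 0 \<le> w i" for w
    using w by (intro bilinear_sum_le_of_quadratic two x y mult_nonneg_nonneg adj_nonneg)
      (simp_all add: adj_commute mult_ac)
  \<comment> \<open>At \<open>u = v = w\<close> the roles exchange: the value is bilinear in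
    \<open>x\<close>, \<open>y\<close> with a matrix built from \<open>w\<close>. Thus
    \<open>three\<close> supplies the quadratic bound for the second polarization.\<close>
  have diag: "bilinear_sum (\<lambda>s t. adj E s t * (x s * y t + y s * x t) / 2) w w
      = bilinear_sum (\<lambda>s t. adj E s t * w s * w t) x y" for w
    by (subst graph_form_eq_bilinear_sum[symmetric])
      (simp add: graph_form_def bilinear_sum_def mult_ac)
  have "bilinear_sum (\<lambda>s t. adj E s t * (x s * y t + y s * x t) / 2) u v
      \<le> (?c * L2_set x UNIV * L2_set y UNIV) * L2_set u UNIV * L2_set v UNIV"
  proof (rule bilinear_sum_le_of_quadratic)
    show "adj E s t * (x s * y t + y s * x t) / 2 = adj E t s * (x t * y s + y t * x s) / 2" for s t
      by (simp add: adj_commute mult_ac add_ac)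
    show "0 \<le> adj E s t * (x s * y t + y s * x t) / 2" for s t
      by (simp add: adj_nonneg x y)
    show "bilinear_sum (\<lambda>s t. adj E s t * (x s * y t + y s * x t) / 2) w w
        \<le> ?c * L2_set x UNIV * L2_set y UNIV * (L2_set w UNIV)\<^sup>2" if "\<And>i. 0 \<le> w i" for w
      unfolding diag using three[of w] that by (simp add: mult_ac)
  qed (rule u v)+
  then show ?thesis by (simp add: graph_form_eq_bilinear_sum mult.assoc)
qed

section \<open>Entries and form of the graph tensor\<close>

text \<open>The first two indices select the edge and the last two repeat them in either order. As
  \<open>s \<noteq> t\<close>, the two orders exclude each other on the edge, so the sum of
  indicators never reaches 2 there.\<close>

lemma edge_tensor_component:
  assumes "s \<noteq> t"
  shows "edge_tensor s t $ i $ j $ k $ l = of_bool ((i, j) = (s, t) \<or> (i, j) = (t, s)) *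
    ((of_bool (k = i \<and> l = j) + of_bool (k = j \<and> l = i)) / 2)"
proof -
  consider "(i, j) = (s, t)" | "(i, j) = (t, s)" | "(i, j) \<noteq> (s, t)" "(i, j) \<noteq> (t, s)"
    by blast
  then show ?thesis
  proof cases
    case 1
    with assms show ?thesis
      by (cases "k = s"; cases "l = t") (simp_all add: edge_tensor_def)
  next
    case 2
    with assms show ?thesis
      by (cases "k = s"; cases "l = t") (simp_all add: edge_tensor_def)
  next
    case 3
    then have "(i, j, k, l) \<notin> {(s, t, s, t), (t, s, t, s), (s, t, t, s), (t, s, s, t)}"
      by blast
    then have "edge_tensor s t $ i $ j $ k $ l = 0"
      unfolding edge_tensor_def vec_lambda_beta by (rule if_not_P)
    with 3 show ?thesis by (simp only: simp_thms of_bool_eq mult_zero_left)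
  qed
qed

text \<open>Only the pair \<open>(min i j, max i j)\<close> can contribute to the sum over edges,
  and for \<open>i = j\<close> it fails the strict order.\<close>

lemma graph_tensor_component:
  "graph_tensor E $ i $ j $ k $ l = complex_of_real (adj E i j) *
     ((of_bool (k = i \<and> l = j) + of_bool (k = j \<and> l = i)) / 2)"
proof -
  let ?r = "(of_bool (k = i \<and> l = j) + of_bool (k = j \<and> l = i)) / 2 :: complex"
  let ?P = "{(s, t). s < t \<and> {s, t} \<in> E}"
  have "graph_tensor E $ i $ j $ k $ l = (\<Sum>e\<in>?P. edge_tensor (fst e) (snd e) $ i $ j $ k $ l)"
    by (simp add: graph_tensor_def sum_component case_prod_beta)
  also have "\<dots> = (\<Sum>e\<in>?P. if e = (min i j, max i j) then ?r else 0)"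
  proof (intro sum.cong refl)
    fix e assume "e \<in> ?P"
    then obtain s t where st: "e = (s, t)" "s < t" by auto
    then have "((i, j) = (s, t) \<or> (i, j) = (t, s)) \<longleftrightarrow> e = (min i j, max i j)"
      by (auto simp: min_def max_def)
    then show "edge_tensor (fst e) (snd e) $ i $ j $ k $ l
        = (if e = (min i j, max i j) then ?r else 0)"
      using st by (simp add: edge_tensor_component del: Pair_inject)
  qed
  also have "\<dots> = (if (min i j, max i j) \<in> ?P then ?r else 0)"
    by (rule sum.delta) simp
  also have "(min i j, max i j) \<in> ?P \<longleftrightarrow> i \<noteq> j \<and> {i, j} \<in> E"
    using insert_commute[of i j "{}"] by (cases i j rule: linorder_cases) auto
  finally show ?thesis by (simp add: adj_def)
qed

text \<open>For fixed first indices \<open>s\<close>, \<open>t\<close> only the last indices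
  \<open>(s, t)\<close> and \<open>(t, s)\<close> survive.\<close>

lemma tensor_inner_graph_tensor:
  "tensor_inner (graph_tensor E) (tensor_product x y u v) =
    (\<Sum>s\<in>UNIV. \<Sum>t\<in>UNIV. complex_of_real (adj E s t) *
       cnj (x$s * y$t * u$s * v$t + x$s * y$t * u$t * v$s) / 2)"
proof -
  have "(\<Sum>k\<in>UNIV. \<Sum>l\<in>UNIV. graph_tensor E $ i $ j $ k $ l * cnj (tensor_product x y u v $ i $ j $ k $ l))
      = complex_of_real (adj E i j) *
       cnj (x$i * y$j * u$i * v$j + x$i * y$j * u$j * v$i) / 2" for i j
  proof -
    have "(\<Sum>k\<in>UNIV. \<Sum>l\<in>UNIV. graph_tensor E $ i $ j $ k $ l * cnj (tensor_product x y u v $ i $ j $ k $ l))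
      = (\<Sum>k\<in>UNIV. \<Sum>l\<in>UNIV.
          (if k = i then if l = j then adj E i j * cnj (x$i * y$j * u$i * v$j) / 2 else 0 else 0)
        + (if k = j then if l = i then adj E i j * cnj (x$i * y$j * u$j * v$i) / 2 else 0 else 0))"
      by (intro sum.cong refl)
        (auto simp: graph_tensor_component tensor_product_def algebra_simps)
    also have "\<dots> = (\<Sum>k\<in>UNIV. (if k = i then adj E i j * cnj (x$i * y$j * u$i * v$j) / 2 else 0)
        + (if k = j then adj E i j * cnj (x$i * y$j * u$j * v$i) / 2 else 0))"
      by (intro sum.cong refl) (auto simp: sum.distrib)
    also have "\<dots> = adj E i j * cnj (x$i * y$j * u$i * v$j) / 2
        + adj E i j * cnj (x$i * y$j * u$j * v$i) / 2"
      by (simp add: sum.distrib)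
    finally show ?thesis by (simp add: algebra_simps add_divide_distrib)
  qed
  then show ?thesis by (simp only: tensor_inner_def)
qed

text \<open>The coefficients are nonnegative, so passing to the moduli of the coordinates can only
  increase the form, and it preserves the norms.\<close>

lemma cmod_tensor_inner_graph_tensor_le:
  "cmod (tensor_inner (graph_tensor E) (tensor_product x y u v))
    \<le> (1 - 1 / clique_number E) * (norm x * norm y * norm u * norm v)"
proof -
  have "cmod (tensor_inner (graph_tensor E) (tensor_product x y u v))
      \<le> graph_form E (\<lambda>i. cmod (x$i)) (\<lambda>i. cmod (y$i)) (\<lambda>i. cmod (u$i)) (\<lambda>i. cmod (v$i))"
    unfolding tensor_inner_graph_tensor graph_form_def
  proof (intro sum_norm_le)
    fix s t
    show "cmod (complex_of_real (adj E s t) *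
       cnj (x$s * y$t * u$s * v$t + x$s * y$t * u$t * v$s) / 2)
      \<le> adj E s t * (cmod (x$s) * cmod (y$t) * cmod (u$s) * cmod (v$t)
          + cmod (x$s) * cmod (y$t) * cmod (u$t) * cmod (v$s)) / 2"
      unfolding norm_divide norm_mult complex_mod_cnj norm_of_real
      using norm_triangle_ineq[of "x$s * y$t * u$s * v$t" "x$s * y$t * u$t * v$s"]
      by (simp add: adj_nonneg mult_left_mono norm_mult)
  qed
  also have "\<dots> \<le> (1 - 1 / clique_number E) * (norm x * norm y * norm u * norm v)"
    unfolding norm_vec_def by (intro graph_form_le) auto
  finally show ?thesis .
qed

section \<open>Attainment of the bound and the spectral norms\<close>

text \<open>Equality holds at the indicator vector of a largest clique: with \<open>k\<close>
  vertices, the form counts the \<open>k * k - k\<close> ordered pairs of distinct vertices, and the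
  fourth power of the norm is \<open>k * k\<close>.\<close>

lemma tensor_inner_graph_tensor_attained:
  fixes E :: "'n::{finite,linorder} set set"
  obtains y :: "(complex, 'n) vec" where "y \<in> vectors_over nonneg_Reals - {0}"
    "tensor_inner (graph_tensor E) (tensor_product y y y y)
      = complex_of_real ((1 - 1 / clique_number E) * norm y ^ 4)"
proof -
  obtain W where W: "clique W E" "card W = clique_number E"
    by (rule clique_number_attained)
  define y :: "(complex, 'n) vec" where "y = (\<chi> i. of_bool (i \<in> W))"
  let ?k = "real (clique_number E)"
  have k: "?k > 0" using clique_number_pos[of E] by simp
  have "norm y ^ 2 = (\<Sum>i\<in>UNIV. of_bool (i \<in> W))"
    unfolding norm_vec_def L2_set_def
    by (subst real_sqrt_pow2, force intro: sum_nonneg, intro sum.cong) (auto simp: y_def)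
  also have "\<dots> = ?k"
    by (simp add: of_bool_def sum.If_cases W(2))
  finally have n2: "norm y ^ 2 = ?k" .
  have "norm y ^ 4 = (norm y ^ 2) ^ 2" by (simp flip: power_mult)
  then have n4: "norm y ^ 4 = ?k ^ 2" using n2 by simp
  have "tensor_inner (graph_tensor E) (tensor_product y y y y)
      = (\<Sum>s\<in>UNIV. \<Sum>t\<in>UNIV. (if s \<in> W \<and> t \<in> W then 1 else 0) - (if t = s then (if s \<in> W then 1 else 0) else 0))"
    unfolding tensor_inner_graph_tensor
    using W(1) by (intro sum.cong refl) (auto simp: y_def adj_def clique_def)
  also have "\<dots> = (\<Sum>s\<in>UNIV. (if s \<in> W then of_nat (card W) else 0) - (if s \<in> W then 1 else 0))"
    by (intro sum.cong refl) (auto simp: sum_subtractf sum.If_cases)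
  also have "\<dots> = of_nat (card W) * of_nat (card W) - of_nat (card W)"
    by (simp add: sum_subtractf sum.If_cases)
  also have "\<dots> = complex_of_real (?k * ?k - ?k)"
    by (simp add: W(2))
  also have "?k * ?k - ?k = (1 - 1 / ?k) * norm y ^ 4"
    using k by (simp add: n4 field_simps power2_eq_square)
  finally have "tensor_inner (graph_tensor E) (tensor_product y y y y)
      = complex_of_real ((1 - 1 / ?k) * norm y ^ 4)" .
  moreover have "y \<noteq> 0" using n2 k by auto
  then have "y \<in> vectors_over nonneg_Reals - {0}"
    by (auto simp: vectors_over_def y_def)
  ultimately show ?thesis using that by blast
qed

text \<open>The upper bound holds for all complex vectors and the maximizer is nonnegative, so every
  \<open>F\<close> containing the nonnegative reals gives the same value. The instances of interest
  are \<open>UNIV\<close> and \<open>\<real>\<close>.\<close>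

lemma spectral_norm_graph_tensor:
  fixes E :: "'n::{finite,linorder} set set"
  assumes "nonneg_Reals \<subseteq> F"
  shows "is_maximum
      {cmod (tensor_inner (graph_tensor E) (tensor_product x y u v)) /
         (norm x * norm y * norm u * norm v) |
       x y u v. x \<in> vectors_over F - {0} \<and> y \<in> vectors_over F - {0} \<and>
                u \<in> vectors_over F - {0} \<and> v \<in> vectors_over F - {0}}
      (1 - 1 / clique_number E)" (is "is_maximum ?S ?c")
    and "spectral_norm F (graph_tensor E) = 1 - 1 / clique_number E"
proof -
  obtain y :: "(complex, 'n) vec" where y: "y \<in> vectors_over nonneg_Reals - {0}"
    "tensor_inner (graph_tensor E) (tensor_product y y y y) = complex_of_real (?c * norm y ^ 4)"
    by (rule tensor_inner_graph_tensor_attained)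
  have c: "0 \<le> ?c" using clique_number_pos[of E] by simp
  have "cmod (tensor_inner (graph_tensor E) (tensor_product y y y y)) = ?c * norm y ^ 4"
    unfolding y(2) norm_of_real using c by (simp add: abs_mult)
  then have "?c = cmod (tensor_inner (graph_tensor E) (tensor_product y y y y)) /
      (norm y * norm y * norm y * norm y)"
    using y(1) by (simp add: power4_eq_xxxx)
  moreover have "y \<in> vectors_over F - {0}"
    using y(1) assms by (auto simp: vectors_over_def)
  ultimately have mem: "?c \<in> ?S" by blast
  have le: "r \<le> ?c" if "r \<in> ?S" for r
  proof -
    from that obtain x y u v where
      r: "r = cmod (tensor_inner (graph_tensor E) (tensor_product x y u v)) /
         (norm x * norm y * norm u * norm v)" and "x \<noteq> 0" "y \<noteq> 0" "u \<noteq> 0" "v \<noteq> 0"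
      by blast
    then have "0 < norm x * norm y * norm u * norm v" by simp
    then show ?thesis
      using cmod_tensor_inner_graph_tensor_le[of E x y u v] by (simp add: r pos_divide_le_eq)
  qed
  from mem le show "is_maximum ?S ?c" by (simp add: is_maximum_def)
  from mem le show "spectral_norm F (graph_tensor E) = ?c"
    unfolding spectral_norm_def by (rule cSup_eq_maximum)
qed

theorem theorem8p4:
  fixes E :: "'n::{finite,linorder} set set" and m :: nat
  assumes "E \<subseteq> nsets UNIV 2" and "card E = m"
  shows "is_maximum
           {cmod (tensor_inner (graph_tensor E) (tensor_product x y u v)) /
              (norm x * norm y * norm u * norm v) |
            x y u v. x \<noteq> 0 \<and> y \<noteq> 0 \<and> u \<noteq> 0 \<and> v \<noteq> 0}
           (spectral_norm UNIV (graph_tensor E))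
    \<and> is_maximum
           {Re (tensor_inner (graph_tensor E) (tensor_product y y y y)) / norm y ^ 4 |
            y. y \<in> vectors_over nonneg_Reals - {0}}
           (spectral_norm UNIV (graph_tensor E))
    \<and> (real (clique_number E) - 1) / real (clique_number E) =
           spectral_norm UNIV (graph_tensor E)
    \<and> spectral_norm UNIV (graph_tensor E) = spectral_norm \<real> (graph_tensor E)"
proof -
  let ?c = "1 - 1 / real (clique_number E)"
  have C: "spectral_norm UNIV (graph_tensor E) = ?c"
    by (rule spectral_norm_graph_tensor) simp
  have R: "spectral_norm \<real> (graph_tensor E) = ?c"
    by (rule spectral_norm_graph_tensor) (auto elim!: nonneg_Reals_cases)
  \<comment> \<open>This quotient has a real part in place of a modulus and a single vector, so it
    is treated directly, with the same maximizer and with the real part bounded by the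
    modulus.\<close>
  have "is_maximum
      {Re (tensor_inner (graph_tensor E) (tensor_product y y y y)) / norm y ^ 4 |
       y. y \<in> vectors_over nonneg_Reals - {0}} ?c" (is "is_maximum ?S _")
    unfolding is_maximum_def
  proof
    obtain y :: "(complex, 'n) vec" where y: "y \<in> vectors_over nonneg_Reals - {0}"
      "tensor_inner (graph_tensor E) (tensor_product y y y y) = complex_of_real (?c * norm y ^ 4)"
      by (rule tensor_inner_graph_tensor_attained)
    then have "?c = Re (tensor_inner (graph_tensor E) (tensor_product y y y y)) / norm y ^ 4"
      unfolding y(2) Re_complex_of_real by simp
    with y(1) show "?c \<in> ?S" by blast
    show "\<forall>r\<in>?S. r \<le> ?c"
    proof
      fix r assume "r \<in> ?S"
      then obtain y :: "(complex, 'n) vec" where "y \<noteq> 0"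
        and r: "r = Re (tensor_inner (graph_tensor E) (tensor_product y y y y)) / norm y ^ 4"
        by blast
      then have "0 < norm y ^ 4" by simp
      moreover have "Re (tensor_inner (graph_tensor E) (tensor_product y y y y)) \<le> ?c * norm y ^ 4"
        using complex_Re_le_cmod cmod_tensor_inner_graph_tensor_le[of E y y y y]
        unfolding power4_eq_xxxx by (rule order_trans)
      ultimately show "r \<le> ?c" by (simp add: r pos_divide_le_eq)
    qed
  qed
  moreover have "is_maximum
      {cmod (tensor_inner (graph_tensor E) (tensor_product x y u v)) /
         (norm x * norm y * norm u * norm v) |
       x y u v. x \<noteq> 0 \<and> y \<noteq> 0 \<and> u \<noteq> 0 \<and> v \<noteq> 0} ?c"
    using spectral_norm_graph_tensor(1)[of UNIV E] by (simp add: vectors_over_def)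
  moreover have "(real (clique_number E) - 1) / real (clique_number E) = ?c"
    using clique_number_pos[of E] by (simp add: diff_divide_distrib)
  ultimately show ?thesis unfolding C R by simp
qed

end
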